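(* Let $E$ be an algebra over $k$ and let $\Theta=(\{\theta^{(i)}\}_{i\in\mathbb{Z}_2},\mathbb{I})$ be a twisting system of $M_2(E)$. Then the $\mathbb{Z}_2$-graded vector space $M_2(E)$ with the multiplication determined by $$\mathbb{I}^{(i)}_{j}x\star \mathbb{I}^{(i')}_{j'}x'=\sum_{s=1}^2\mathbb{I}^{(i)}_{j}\mathbb{I}^{(i')}_{s}\theta^{(i')}_{sj'}(x)x'=\sum_{s,t=1}^2\mathbb{I}^{(i+i')}_{t}l^{(ii')}_{tjs}\theta^{(i')}_{sj'}(x)x'$$ for all $x,x'\in E$, $i,i'\in\mathbb{Z}_2$, $j,j'\in\{1,2\}$, is a $\mathbb{Z}_2$-graded (associative unital) algebra with identity $\sum_{j,s=1}^2\gamma_s\varphi^{(0)}_{sj}(1)\mathbb{I}^{(0)}_j$, where $\varphi^{(0)}$ is the $t$-inverse of $\theta^{(0)}$.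
   Context: $k$ is an algebraically closed field of characteristic $0$. $M_2(k)$ is $\mathbb{Z}_2$-graded with $M_2(k)_0$ the diagonal and $M_2(k)_1$ the anti-diagonal matrices. An invertible $\mathbb{Z}_2$-graded basis of $M_2(k)$ is $\mathbb{I}=\{\mathbb{I}^{(i)}_j\mid i\in\mathbb{Z}_2,j=1,2\}$ with $\mathbb{I}^{(i)}_1,\mathbb{I}^{(i)}_2$ invertible matrices forming a basis of $M_2(k)_i$. The scalars $l^{(ii')}_{sjj'}\in k$ are defined by $\mathbb{I}^{(i)}_j\mathbb{I}^{(i')}_{j'}=\sum_{s=1}^2\mathbb{I}^{(i+i')}_sl^{(ii')}_{sjj'}$, and $\gamma_1,\gamma_2\in k$ by $\gamma_1\mathbb{I}^{(0)}_1+\gamma_2\mathbb{I}^{(0)}_2=I_2$. One has $M_2(E)=\bigoplus_i M_2(E)_i$ with $M_2(E)_i=\mathbb{I}^{(i)}_1E\oplus\mathbb{I}^{(i)}_2E$, where $\mathbb{I}^{(i)}_jx$ denotes the matrix $\mathbb{I}^{(i)}_j$ multiplied entrywise by $x\in E$. A linear map $\theta=(\theta_{jj'}):E\to M_2(E)$ is $t$-invertible if there is a linear map $\varphi=(\varphi_{jj'}):E\to M_2(E)$ (its unique $t$-inverse) with $\sum_{r=1}^2\varphi_{ri}\theta_{rj}=\delta_{ij}\mathrm{id}_E$ and $\sum_{r=1}^2\theta_{jr}\varphi_{ir}=\delta_{ij}\mathrm{id}_E$ for $i,j=1,2$ (products are compositions). A twisting system of $M_2(E)$ is a pair $\Theta=(\{\theta^{(i)}\}_{i\in\mathbb{Z}_2},\mathbb{I})$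 where $\mathbb{I}$ is an invertible $\mathbb{Z}_2$-graded basis of $M_2(k)$ and $\theta^{(0)},\theta^{(1)}:E\to M_2(E)$ are $t$-invertible linear maps such that (1) for all $x,x'\in E$, $i',i''\in\mathbb{Z}_2$, $j',j'',p\in\{1,2\}$: $\sum_{s,u=1}^2l^{(i'i'')}_{psu}\theta^{(i'')}_{uj''}(\theta^{(i')}_{sj'}(x)x')=\sum_{t,u=1}^2l^{(i'i'')}_{tj'u}\theta^{(i'+i'')}_{pt}(x)\theta^{(i'')}_{uj''}(x')$; (2) $\theta^{(1)}(1)\in GL_2(k)$ (equivalently $\theta^{(0)}(1)\in GL_2(k)$). *)

theory Defs
  imports "HOL-Analysis.Analysis" "HOL-Library.Z2" "HOL-Computational_Algebra.Polynomial"
begin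

text \<open>
  The grading group is the type \<open>bit\<close> (integers mod 2); matrix rows, columns and the
  lower indices \<open>j = 1, 2\<close> range over the two-element type \<open>2\<close>, in which the numeral
  \<open>2\<close> is the element other than \<open>1\<close>.
\<close>

locale unital_algebra = vector_space smul
  for smul :: "'k::field \<Rightarrow> 'v::ab_group_add \<Rightarrow> 'v" +
  fixes mult :: "'v \<Rightarrow> 'v \<Rightarrow> 'v" and unit :: 'v
  assumes linear_mult_right: "Vector_Spaces.linear smul smul (\<lambda>y. mult x y)"
    and linear_mult_left: "Vector_Spaces.linear smul smul (\<lambda>x. mult x y)"
    and mult_assoc: "mult (mult x y) z = mult x (mult y z)"
    and mult_unit_left: "mult unit x = x"
    and mult_unit_right: "mult x unit = x"

locale Z2_graded_algebra = unital_algebra smul mult unit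
  for smul :: "'k::field \<Rightarrow> 'v::ab_group_add \<Rightarrow> 'v" and mult unit +
  fixes comp :: "bit \<Rightarrow> 'v set"
  assumes comp_subspace: "subspace (comp i)"
    and comp_direct_sum: "\<exists>!f. (\<forall>i. f i \<in> comp i) \<and> v = f 0 + f 1"
    and comp_mult: "x \<in> comp i \<Longrightarrow> y \<in> comp i' \<Longrightarrow> mult x y \<in> comp (i + i')"
    and unit_comp: "unit \<in> comp 0"

definition mat_scale :: "('k \<Rightarrow> 'e \<Rightarrow> 'e) \<Rightarrow> 'k \<Rightarrow> 'e^2^2 \<Rightarrow> 'e^2^2" where
  "mat_scale smul c X = (\<chi> a b. smul c (X $ a $ b))"

text \<open>For \<open>A\<close> over \<open>k\<close> and \<open>x\<close> in \<open>E\<close>, this is the matrix \<open>A x\<close> over \<open>E\<close>.\<close>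

definition mat_elem :: "('k \<Rightarrow> 'e \<Rightarrow> 'e) \<Rightarrow> 'k^2^2 \<Rightarrow> 'e \<Rightarrow> 'e^2^2" where
  "mat_elem smul A x = (\<chi> a b. smul (A $ a $ b) x)"

definition mat_comp :: "bit \<Rightarrow> ('k::field^2^2) set" where
  "mat_comp i =
    (if i = 0 then {A. \<forall>a b. a \<noteq> b \<longrightarrow> A $ a $ b = 0} else {A. \<forall>a. A $ a $ a = 0})"

definition invertible_graded_basis :: "(bit \<Rightarrow> 2 \<Rightarrow> 'k::field^2^2) \<Rightarrow> bool" where
  "invertible_graded_basis \<I> \<longleftrightarrow>
    (\<forall>i j. invertible (\<I> i j)) \<and>
    (\<forall>i. inj (\<I> i) \<and> \<not> module.dependent (mat_scale (*)) (range (\<I> i)) \<and>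
         module.span (mat_scale (*)) (range (\<I> i)) = mat_comp i)"

text \<open>
  \<open>struct_const \<I> i i' s j j'\<close> is the scalar with upper index \<open>(i i')\<close> and lower index \<open>s j j'\<close>.
  This and \<open>unit_coord\<close> are determined for every invertible graded basis; see
  \<open>struct_const_eq\<close>, \<open>struct_const_unique\<close>, \<open>unit_coord_eq\<close> and \<open>unit_coord_unique\<close> below.
\<close>

definition struct_const ::
    "(bit \<Rightarrow> 2 \<Rightarrow> 'k::field^2^2) \<Rightarrow> bit \<Rightarrow> bit \<Rightarrow> 2 \<Rightarrow> 2 \<Rightarrow> 2 \<Rightarrow> 'k" where
  "struct_const \<I> i i' =
    (THE l. \<forall>j j'. \<I> i j ** \<I> i' j' = (\<Sum>s\<in>UNIV. mat_scale (*) (l s j j') (\<I> (i + i') s)))"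

definition unit_coord :: "(bit \<Rightarrow> 2 \<Rightarrow> 'k::field^2^2) \<Rightarrow> 2 \<Rightarrow> 'k" where
  "unit_coord \<I> = (THE \<gamma>. (\<Sum>s\<in>UNIV. mat_scale (*) (\<gamma> s) (\<I> 0 s)) = mat 1)"

definition M2E_comp ::
    "('k \<Rightarrow> 'e \<Rightarrow> 'e) \<Rightarrow> (bit \<Rightarrow> 2 \<Rightarrow> 'k^2^2) \<Rightarrow> bit \<Rightarrow> ('e::ab_group_add^2^2) set" where
  "M2E_comp smul \<I> i = {mat_elem smul (\<I> i 1) x + mat_elem smul (\<I> i 2) y | x y. True}"

text \<open>A map \<open>\<theta>\<close> from \<open>E\<close> to matrices over \<open>E\<close> has components \<open>\<lambda>x. \<theta> x $ j $ j'\<close>.\<close>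

definition is_t_inverse ::
    "('k::field \<Rightarrow> 'e::ab_group_add \<Rightarrow> 'e) \<Rightarrow> ('e \<Rightarrow> 'e^2^2) \<Rightarrow> ('e \<Rightarrow> 'e^2^2) \<Rightarrow> bool" where
  "is_t_inverse smul \<theta> \<phi> \<longleftrightarrow>
    Vector_Spaces.linear smul (mat_scale smul) \<phi> \<and>
    (\<forall>i j x. (\<Sum>r\<in>UNIV. \<phi> (\<theta> x $ r $ j) $ r $ i) = (if i = j then x else 0)) \<and>
    (\<forall>i j x. (\<Sum>r\<in>UNIV. \<theta> (\<phi> x $ i $ r) $ j $ r) = (if i = j then x else 0))"

definition t_invertible ::
    "('k::field \<Rightarrow> 'e::ab_group_add \<Rightarrow> 'e) \<Rightarrow> ('e \<Rightarrow> 'e^2^2) \<Rightarrow> bool" where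
  "t_invertible smul \<theta> \<longleftrightarrow>
    Vector_Spaces.linear smul (mat_scale smul) \<theta> \<and> (\<exists>\<phi>. is_t_inverse smul \<theta> \<phi>)"

definition t_inverse ::
    "('k::field \<Rightarrow> 'e::ab_group_add \<Rightarrow> 'e) \<Rightarrow> ('e \<Rightarrow> 'e^2^2) \<Rightarrow> ('e \<Rightarrow> 'e^2^2)" where
  "t_inverse smul \<theta> = (THE \<phi>. is_t_inverse smul \<theta> \<phi>)"

text \<open>
  The sort \<open>{ring, monoid_mult}\<close> is that of unital rings without the requirement \<open>0 \<noteq> 1\<close>,
  so that the zero algebra is included.
  In the last condition, \<open>GL\<^sub>2(k)\<close> is viewed inside the matrices over \<open>E\<close> via \<open>A \<mapsto> A 1\<close>.
\<close>

definition twisting_system ::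
    "('k::field \<Rightarrow> 'e::{ring,monoid_mult} \<Rightarrow> 'e) \<Rightarrow> (bit \<Rightarrow> 'e \<Rightarrow> 'e^2^2) \<Rightarrow>
     (bit \<Rightarrow> 2 \<Rightarrow> 'k^2^2) \<Rightarrow> bool" where
  "twisting_system smul \<theta> \<I> \<longleftrightarrow>
    invertible_graded_basis \<I> \<and>
    (\<forall>i. t_invertible smul (\<theta> i)) \<and>
    (\<forall>x x' i' i'' j' j'' p.
      (\<Sum>s\<in>UNIV. \<Sum>u\<in>UNIV. smul (struct_const \<I> i' i'' p s u)
          (\<theta> i'' (\<theta> i' x $ s $ j' * x') $ u $ j'')) =
      (\<Sum>t\<in>UNIV. \<Sum>u\<in>UNIV. smul (struct_const \<I> i' i'' t j' u)
          (\<theta> (i' + i'') x $ p $ t * \<theta> i'' x' $ u $ j''))) \<and>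
    (\<exists>A. invertible A \<and> \<theta> 1 1 = mat_elem smul A 1)"

definition is_twisted_mult ::
    "('k::field \<Rightarrow> 'e::{ring,monoid_mult} \<Rightarrow> 'e) \<Rightarrow> (bit \<Rightarrow> 'e \<Rightarrow> 'e^2^2) \<Rightarrow>
     (bit \<Rightarrow> 2 \<Rightarrow> 'k^2^2) \<Rightarrow> ('e^2^2 \<Rightarrow> 'e^2^2 \<Rightarrow> 'e^2^2) \<Rightarrow> bool" where
  "is_twisted_mult smul \<theta> \<I> m \<longleftrightarrow>
    (\<forall>X. Vector_Spaces.linear (mat_scale smul) (mat_scale smul) (\<lambda>Y. m X Y)) \<and>
    (\<forall>Y. Vector_Spaces.linear (mat_scale smul) (mat_scale smul) (\<lambda>X. m X Y)) \<and>
    (\<forall>x x' i i' j j'.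
      m (mat_elem smul (\<I> i j) x) (mat_elem smul (\<I> i' j') x') =
        (\<Sum>s\<in>UNIV. mat_elem smul (\<I> i j ** \<I> i' s) (\<theta> i' x $ s $ j' * x')) \<and>
      m (mat_elem smul (\<I> i j) x) (mat_elem smul (\<I> i' j') x') =
        (\<Sum>s\<in>UNIV. \<Sum>t\<in>UNIV. mat_elem smul (\<I> (i + i') t)
            (smul (struct_const \<I> i i' t j s) (\<theta> i' x $ s $ j' * x'))))"

definition twisted_unit ::
    "('k::field \<Rightarrow> 'e::{ring,monoid_mult} \<Rightarrow> 'e) \<Rightarrow> (bit \<Rightarrow> 'e \<Rightarrow> 'e^2^2) \<Rightarrow>
     (bit \<Rightarrow> 2 \<Rightarrow> 'k^2^2) \<Rightarrow> 'e^2^2" where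
  "twisted_unit smul \<theta> \<I> =
    (\<Sum>j\<in>UNIV. \<Sum>s\<in>UNIV. mat_elem smul (\<I> 0 j)
        (smul (unit_coord \<I> s) (t_inverse smul (\<theta> 0) 1 $ s $ j)))"

lemma vector_space_mat_scale:
  assumes "vector_space smul"
  shows "vector_space (mat_scale smul)"
proof -
  interpret vector_space smul by fact
  show ?thesis
    by unfold_locales (auto simp: mat_scale_def vec_eq_iff scale_right_distrib scale_left_distrib)
qed

lemma vector_space_mat_mult: "vector_space (mat_scale ((*) :: 'k::field \<Rightarrow> _))"
  by (rule vector_space_mat_scale) (unfold_locales, auto simp: algebra_simps)

lemma graded_basis_coords:
  assumes "invertible_graded_basis \<I>" and "A \<in> mat_comp i"
  shows "\<exists>!c. A = (\<Sum>s\<in>UNIV. mat_scale (*) (c s) (\<I> i s))"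
proof -
  interpret V: vector_space "mat_scale ((*) :: 'a \<Rightarrow> _)" by (rule vector_space_mat_mult)
  have inj: "inj (\<I> i)" and ind: "V.independent (range (\<I> i))"
    and spn: "V.span (range (\<I> i)) = mat_comp i"
    using assms(1) by (auto simp: invertible_graded_basis_def)
  have re: "(\<Sum>v\<in>range (\<I> i). mat_scale (*) (d v) v) = (\<Sum>s\<in>UNIV. mat_scale (*) (d (\<I> i s)) (\<I> i s))"
    for d
    using inj by (simp add: sum.reindex)
  have "A \<in> range (\<lambda>u. \<Sum>v\<in>range (\<I> i). mat_scale (*) (u v) v)"
    using assms(2) spn V.span_finite[of "range (\<I> i)"] by auto
  then obtain u where "A = (\<Sum>s\<in>UNIV. mat_scale (*) (u (\<I> i s)) (\<I> i s))"
    unfolding re by auto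
  moreover have "c = d"
    if c: "A = (\<Sum>s\<in>UNIV. mat_scale (*) (c s) (\<I> i s))"
      and d: "A = (\<Sum>s\<in>UNIV. mat_scale (*) (d s) (\<I> i s))" for c d
  proof
    fix s
    define u where "u v = c (inv (\<I> i) v) - d (inv (\<I> i) v)" for v
    have "(\<Sum>v\<in>range (\<I> i). mat_scale (*) (u v) v) = 0"
      unfolding re using inj c d
      by (simp add: u_def V.scale_left_diff_distrib sum_subtractf)
    then have "u (\<I> i s) = 0"
      using V.independentD[OF ind finite_imageI[OF finite] order_refl] by auto
    then show "c s = d s" using inj by (simp add: u_def)
  qed
  ultimately show ?thesis by (intro ex1I[of _ "\<lambda>s. u (\<I> i s)"])
qed

lemma graded_basis_in_comp:
  assumes "invertible_graded_basis \<I>"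
  shows "\<I> i j \<in> mat_comp i"
proof -
  interpret V: vector_space "mat_scale ((*) :: 'a \<Rightarrow> _)" by (rule vector_space_mat_mult)
  have "\<I> i j \<in> V.span (range (\<I> i))" by (intro V.span_base rangeI)
  with assms show ?thesis by (simp add: invertible_graded_basis_def)
qed

lemma mat_comp_mult:
  assumes "A \<in> mat_comp i" and "B \<in> mat_comp i'"
  shows "A ** B \<in> mat_comp (i + i')"
proof (cases i; cases i')
qed (use assms in \<open>auto simp: mat_comp_def matrix_matrix_mult_def sum_2 forall_2\<close>)

lemma struct_const_ex1:
  assumes "invertible_graded_basis \<I>"
  shows "\<exists>!l. \<forall>j j'. \<I> i j ** \<I> i' j' = (\<Sum>s\<in>UNIV. mat_scale (*) (l s j j') (\<I> (i + i') s))"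
proof -
  have *: "\<exists>!c. \<I> i j ** \<I> i' j' = (\<Sum>s\<in>UNIV. mat_scale (*) (c s) (\<I> (i + i') s))" for j j'
    by (intro graded_basis_coords mat_comp_mult graded_basis_in_comp assms)
  then obtain c where c: "\<And>j j'. \<I> i j ** \<I> i' j' = (\<Sum>s\<in>UNIV. mat_scale (*) (c j j' s) (\<I> (i + i') s))"
    by metis
  show ?thesis
  proof (rule ex1I[where a = "\<lambda>s j j'. c j j' s"])
    fix l
    assume l: "\<forall>j j'. \<I> i j ** \<I> i' j' = (\<Sum>s\<in>UNIV. mat_scale (*) (l s j j') (\<I> (i + i') s))"
    have "(\<lambda>s. l s j j') = c j j'" for j j'
    proof (rule trans[OF the1_equality[OF *[of j j'], symmetric] the1_equality[OF *[of j j']]])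
      show "\<I> i j ** \<I> i' j' = (\<Sum>s\<in>UNIV. mat_scale (*) (l s j j') (\<I> (i + i') s))"
        using l by simp
    qed (rule c)
    then show "l = (\<lambda>s j j'. c j j' s)" by (simp add: fun_eq_iff)
  qed (intro allI, rule c)
qed

lemma struct_const_eq:
  assumes "invertible_graded_basis \<I>"
  shows "\<I> i j ** \<I> i' j' =
    (\<Sum>s\<in>UNIV. mat_scale (*) (struct_const \<I> i i' s j j') (\<I> (i + i') s))"
  using theI'[OF struct_const_ex1[OF assms, of i i']] unfolding struct_const_def by blast

lemma struct_const_unique:
  assumes "invertible_graded_basis \<I>"
    and "\<And>j j'. \<I> i j ** \<I> i' j' = (\<Sum>s\<in>UNIV. mat_scale (*) (l s j j') (\<I> (i + i') s))"
  shows "struct_const \<I> i i' = l"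
  unfolding struct_const_def by (rule the1_equality[OF struct_const_ex1[OF assms(1)]]) (use assms(2) in blast)

lemma unit_coord_ex1:
  assumes "invertible_graded_basis \<I>"
  shows "\<exists>!\<gamma>. (\<Sum>s\<in>UNIV. mat_scale (*) (\<gamma> s) (\<I> 0 s)) = mat 1"
proof -
  have "mat 1 \<in> mat_comp 0" by (simp add: mat_comp_def mat_def)
  then have "\<exists>!\<gamma>. mat 1 = (\<Sum>s\<in>UNIV. mat_scale (*) (\<gamma> s) (\<I> 0 s))"
    by (rule graded_basis_coords[OF assms])
  then show ?thesis by (subst eq_commute)
qed

lemma unit_coord_eq:
  assumes "invertible_graded_basis \<I>"
  shows "(\<Sum>s\<in>UNIV. mat_scale (*) (unit_coord \<I> s) (\<I> 0 s)) = mat 1"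
  using theI'[OF unit_coord_ex1[OF assms]] unfolding unit_coord_def by blast

lemma unit_coord_unique:
  assumes "invertible_graded_basis \<I>"
    and "(\<Sum>s\<in>UNIV. mat_scale (*) (\<gamma> s) (\<I> 0 s)) = mat 1"
  shows "unit_coord \<I> = \<gamma>"
  unfolding unit_coord_def by (rule the1_equality[OF unit_coord_ex1[OF assms(1)]]) (rule assms(2))

lemma is_t_inverse_unique:
  assumes "is_t_inverse smul \<theta> \<phi>" and "is_t_inverse smul \<theta> \<psi>"
  shows "\<phi> = \<psi>"
proof -
  interpret \<phi>: Vector_Spaces.linear smul "mat_scale smul" \<phi>
    using assms(1) by (simp add: is_t_inverse_def)
  have add: "\<phi> (x + y) = \<phi> x + \<phi> y" for x y
    by (rule \<phi>.add)
  have zero: "\<phi> 0 = 0"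
    using add[of 0 0] by simp
  have l: "(\<Sum>r\<in>UNIV. \<phi> (\<theta> x $ r $ j) $ r $ i) = (if i = j then x else 0)" for i j x
    using assms(1) by (auto simp: is_t_inverse_def)
  have r: "(\<Sum>r\<in>UNIV. \<theta> (\<psi> x $ i $ r) $ j $ r) = (if i = j then x else 0)" for i j x
    using assms(2) by (auto simp: is_t_inverse_def)
  have "\<phi> x $ a $ b = \<psi> x $ a $ b" for x a b
  proof -
    have "\<psi> x $ a $ b = (\<Sum>q\<in>UNIV. \<Sum>r\<in>UNIV. \<phi> (\<theta> (\<psi> x $ a $ q) $ r $ q) $ r $ b)"
      unfolding l by simp
    also have "\<dots> = (\<Sum>r\<in>UNIV. \<phi> (\<Sum>q\<in>UNIV. \<theta> (\<psi> x $ a $ q) $ r $ q) $ r $ b)"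
      by (simp add: sum_2 add)
    also have "\<dots> = (\<Sum>r\<in>UNIV. if a = r then \<phi> x $ r $ b else 0)"
      unfolding r by (rule sum.cong) (auto simp: zero)
    finally show ?thesis by simp
  qed
  then show ?thesis by (simp add: fun_eq_iff vec_eq_iff)
qed

lemma t_inverse_eqI: "is_t_inverse smul \<theta> \<phi> \<Longrightarrow> t_inverse smul \<theta> = \<phi>"
  unfolding t_inverse_def by (blast intro: is_t_inverse_unique)

lemma is_t_inverse_t_inverse: "t_invertible smul \<theta> \<Longrightarrow> is_t_inverse smul \<theta> (t_inverse smul \<theta>)"
  unfolding t_invertible_def using t_inverse_eqI by metis

end

(* For x in E let L x be the right E-linear operator on M_2(E) with
   L x (I_j y) = sum_s I_s theta_sj(x) y, so that A x * Y = A (L x Y) for a scalar matrix A.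
   Condition (1) says that L x (Y) * Z = L x (Y * Z), which gives associativity.
   For the unit, condition (2) and t-invertibility show that L 1 is left multiplication by an
   invertible scalar matrix D, so D^-1 is a left unit.  It is also a right unit: by
   t-invertibility every element is a sum of products Y * I_r, and
   I_r * D^-1 = I_r (L 1 (D^-1)) = I_r. *)

theory Submission
  imports Defs
begin

section \<open>Linearity and sums over the grading group\<close>

lemma linearI':
  assumes "vector_space s1" "vector_space s2"
    and "\<And>x y. f (x + y) = f x + f y" "\<And>c x. f (s1 c x) = s2 c (f x)"
  shows "Vector_Spaces.linear s1 s2 f"
  using assms by (simp add: Vector_Spaces.linear_iff)

lemma UNIV_bit: "UNIV = {0, 1 :: bit}"
  by (auto intro: bit.exhaust)

lemma finite_UNIV_bit [simp]: "finite (UNIV :: bit set)"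
  by (simp add: UNIV_bit)

lemma sum_bit: "sum f (UNIV :: bit set) = f 0 + f 1"
  by (simp add: UNIV_bit)

text \<open>Diagonal and anti-diagonal matrices are complementary, so the four
  \<open>\<I> i j\<close> form a basis of all 2x2 matrices. \<open>\<kappa>\<close> is the dual
  basis for the entrywise pairing; it gives coordinates of matrices over E by an explicit
  formula.\<close>

lemma invertible_graded_basis_dual:
  fixes \<I> :: "bit \<Rightarrow> 2 \<Rightarrow> 'k::field^2^2"
  assumes "invertible_graded_basis \<I>"
  shows "\<exists>\<kappa> :: bit \<Rightarrow> 2 \<Rightarrow> 2 \<Rightarrow> 2 \<Rightarrow> 'k.
    (\<forall>a b c d. (\<Sum>i\<in>UNIV. \<Sum>j\<in>UNIV. \<kappa> i j a b * \<I> i j $ c $ d) = of_bool (a = c \<and> b = d)) \<and>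
    (\<forall>i j i' j'. (\<Sum>a\<in>UNIV. \<Sum>b\<in>UNIV. \<kappa> i j a b * \<I> i' j' $ a $ b) = of_bool (i = i' \<and> j = j'))"
proof -
  \<comment> \<open>The matrix unit \<open>U a b\<close> is homogeneous of degree
    \<open>ix a b\<close>, so it expands in the basis of that degree alone; \<open>\<kappa>\<close>
    collects the coefficients.\<close>
  define ix :: "2 \<Rightarrow> 2 \<Rightarrow> bit" where "ix a b = (if a = b then 0 else 1)" for a b
  define U :: "2 \<Rightarrow> 2 \<Rightarrow> 'k^2^2" where "U a b = (\<chi> c d. of_bool (a = c \<and> b = d))" for a b
  have "U a b \<in> mat_comp (ix a b)" for a b
    by (auto simp: U_def ix_def mat_comp_def)
  then have "\<exists>c. U a b = (\<Sum>s\<in>UNIV. mat_scale (*) (c s) (\<I> (ix a b) s))" for a b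
    using graded_basis_coords[OF assms] by blast
  then obtain c where c: "\<And>a b. U a b = (\<Sum>s\<in>UNIV. mat_scale (*) (c a b s) (\<I> (ix a b) s))"
    by metis
  define \<kappa> where "\<kappa> i j a b = (if i = ix a b then c a b j else 0)" for i j a b
  have 1: "(\<Sum>i\<in>UNIV. \<Sum>j\<in>UNIV. \<kappa> i j a b * \<I> i j $ p $ q) = of_bool (a = p \<and> b = q)" for a b p q
  proof -
    have "(\<Sum>i\<in>UNIV. \<Sum>j\<in>UNIV. \<kappa> i j a b * \<I> i j $ p $ q)
        = (\<Sum>i\<in>UNIV. if i = ix a b then (\<Sum>j\<in>UNIV. c a b j * \<I> i j $ p $ q) else 0)"
      by (rule sum.cong) (auto simp: \<kappa>_def)
    also have "\<dots> = U a b $ p $ q"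
      by (subst c) (simp add: mat_scale_def)
    finally show ?thesis by (simp add: U_def)
  qed
  have zero: "\<I> i' j $ a $ b = 0" if "i' \<noteq> ix a b" for i' j a b
    using graded_basis_in_comp[OF assms, of i' j] that by (auto simp: ix_def mat_comp_def split: if_splits)
  have 2: "(\<Sum>a\<in>UNIV. \<Sum>b\<in>UNIV. \<kappa> i j a b * \<I> i' j' $ a $ b) = of_bool (i = i' \<and> j = j')"
    for i j i' j'
  proof (cases "i = i'")
    case False
    then have k: "\<kappa> i j a b * \<I> i' j' $ a $ b = 0" for a b
      using zero[of i' a b j'] by (auto simp: \<kappa>_def)
    show ?thesis unfolding k using False by simp
  next
    case True
    have uniq: "f = g" if "\<I> i j' = (\<Sum>s\<in>UNIV. mat_scale (*) (f s) (\<I> i s))"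
      and "\<I> i j' = (\<Sum>s\<in>UNIV. mat_scale (*) (g s) (\<I> i s))" for f g
      using graded_basis_coords[OF assms graded_basis_in_comp[OF assms, of i j']] that by blast
    \<comment> \<open>Uniqueness of coordinates yields orthogonality once the pairings with
      \<open>\<kappa>\<close> are known to be coordinates of \<open>\<I> i j'\<close>. For this,
      split \<open>\<I> i j'\<close> into matrix units and apply completeness to each.\<close>
    have "\<I> i j' = (\<Sum>s\<in>UNIV. mat_scale (*) (\<Sum>a\<in>UNIV. \<Sum>b\<in>UNIV. \<kappa> i s a b * \<I> i j' $ a $ b) (\<I> i s))"
    proof -
      have expand: "(\<Sum>s\<in>UNIV. (\<Sum>a\<in>UNIV. \<Sum>b\<in>UNIV. \<kappa> i s a b * \<I> i j' $ a $ b) * \<I> i s $ p $ q)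
          = \<I> i j' $ p $ q"
        for p q
      proof -
        have k: "(\<Sum>s\<in>UNIV. \<kappa> i s a b * \<I> i j' $ a $ b * \<I> i s $ p $ q)
            = \<I> i j' $ a $ b * of_bool (a = p \<and> b = q)" for a b
        proof -
          \<comment> \<open>Only \<open>i' = i\<close> contributes: \<open>\<kappa> i' s a b\<close>
            vanishes unless \<open>i' = ix a b\<close>, and if that differs from \<open>i\<close>,
            the entry of \<open>\<I> i j'\<close> at \<open>a\<close>, \<open>b\<close> is
            zero.\<close>
          have "(\<Sum>i'\<in>UNIV. \<Sum>s\<in>UNIV. \<kappa> i' s a b * \<I> i' s $ p $ q) * \<I> i j' $ a $ b
             = (\<Sum>i'\<in>UNIV. if i' = i then \<Sum>s\<in>UNIV. \<kappa> i s a b * \<I> i j' $ a $ b * \<I> i s $ p $ q else 0)"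
            unfolding sum_distrib_right
            by (rule sum.cong) (use zero[of i a b j'] in \<open>force simp: \<kappa>_def algebra_simps\<close>)+
          then show ?thesis unfolding 1 by (simp add: mult.commute)
        qed
        have "(\<Sum>s\<in>UNIV. (\<Sum>a\<in>UNIV. \<Sum>b\<in>UNIV. \<kappa> i s a b * \<I> i j' $ a $ b) * \<I> i s $ p $ q)
          = (\<Sum>a\<in>UNIV. \<Sum>b\<in>UNIV. \<Sum>s\<in>UNIV. \<kappa> i s a b * \<I> i j' $ a $ b * \<I> i s $ p $ q)"
          by (simp add: sum_2 algebra_simps)
        also have "\<dots> = \<I> i j' $ p $ q"
          unfolding k using exhaust_2[of p] exhaust_2[of q] by (auto simp: sum_2)
        finally show ?thesis .
      qed
      show ?thesis
        unfolding vec_eq_iff sum_component mat_scale_def vec_lambda_beta expand by simp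
    qed
    moreover have "\<I> i j' = (\<Sum>s\<in>UNIV. mat_scale (*) (of_bool (s = j')) (\<I> i s))"
      using exhaust_2[of j'] by (auto simp: sum_2 mat_scale_def vec_eq_iff)
    ultimately have "(\<lambda>s. \<Sum>a\<in>UNIV. \<Sum>b\<in>UNIV. \<kappa> i s a b * \<I> i j' $ a $ b) = (\<lambda>s. of_bool (s = j'))"
      by (rule uniq)
    from fun_cong[OF this, of j] True show ?thesis by simp
  qed
  from 1 2 show ?thesis by blast
qed

definition left_mult :: "('k \<Rightarrow> 'e \<Rightarrow> 'e) \<Rightarrow> 'k^2^2 \<Rightarrow> 'e::ab_group_add^2^2 \<Rightarrow> 'e^2^2" where
  "left_mult smul A X = (\<chi> a b. \<Sum>c\<in>UNIV. smul (A $ a $ c) (X $ c $ b))"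

locale twisted_matrix_algebra = unital_algebra smul "(*)" 1
  for smul :: "'k::field \<Rightarrow> 'e::{ring,monoid_mult} \<Rightarrow> 'e" +
  fixes \<theta> :: "bit \<Rightarrow> 'e \<Rightarrow> 'e^2^2"
    and \<I> :: "bit \<Rightarrow> 2 \<Rightarrow> 'k^2^2"
    and \<kappa> :: "bit \<Rightarrow> 2 \<Rightarrow> 2 \<Rightarrow> 2 \<Rightarrow> 'k"
  assumes twisting: "twisting_system smul \<theta> \<I>"
    and dual_complete:
      "(\<Sum>i\<in>UNIV. \<Sum>j\<in>UNIV. \<kappa> i j a b * \<I> i j $ c $ d) = of_bool (a = c \<and> b = d)"
    and dual_orthogonal:
      "(\<Sum>a\<in>UNIV. \<Sum>b\<in>UNIV. \<kappa> i j a b * \<I> i' j' $ a $ b) = of_bool (i = i' \<and> j = j')"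
begin

abbreviation ME :: "'k^2^2 \<Rightarrow> 'e \<Rightarrow> 'e^2^2" where "ME \<equiv> mat_elem smul"
abbreviation lm :: "'k^2^2 \<Rightarrow> 'e^2^2 \<Rightarrow> 'e^2^2" where "lm \<equiv> left_mult smul"
abbreviation l where "l \<equiv> struct_const \<I>"

lemma smul_mult_left: "smul c x * y = smul c (x * y)"
  using linear_mult_left by (simp add: Vector_Spaces.linear_iff)

lemma smul_mult_right: "x * smul c y = smul c (x * y)"
  using linear_mult_right by (simp add: Vector_Spaces.linear_iff)

lemma basis: "invertible_graded_basis \<I>"
  using twisting by (simp add: twisting_system_def)

lemma vs_mat: "vector_space (mat_scale smul)"
  by (rule vector_space_mat_scale) unfold_locales

section \<open>Scalar matrices acting on matrices over E, and coordinates\<close>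

lemma ME_add: "ME A (x + y) = ME A x + ME A y"
  by (simp add: mat_elem_def vec_eq_iff scale_right_distrib)

lemma ME_zero [simp]: "ME A 0 = 0"
  by (simp add: mat_elem_def vec_eq_iff)

lemma ME_sum: "ME A (sum f S) = (\<Sum>s\<in>S. ME A (f s))"
  by (simp add: mat_elem_def vec_eq_iff scale_sum_right)

lemma ME_matrix_sum: "ME (\<Sum>s\<in>S. mat_scale (*) (c s) (B s)) x = (\<Sum>s\<in>S. ME (B s) (smul (c s) x))"
  by (simp add: mat_elem_def vec_eq_iff mat_scale_def scale_sum_left mult.commute)

lemma ME_smul: "ME A (smul c x) = mat_scale smul c (ME A x)"
  by (simp add: mat_elem_def mat_scale_def vec_eq_iff mult.commute)

lemma lm_ME: "lm A (ME B x) = ME (A ** B) x"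
  by (simp add: left_mult_def mat_elem_def vec_eq_iff matrix_matrix_mult_def scale_sum_left)

lemma lm_add: "lm A (X + Y) = lm A X + lm A Y"
  by (simp add: left_mult_def vec_eq_iff scale_right_distrib sum.distrib)

lemma lm_zero [simp]: "lm A 0 = 0"
  by (simp add: left_mult_def vec_eq_iff)

lemma lm_sum: "lm A (sum f S) = (\<Sum>s\<in>S. lm A (f s))"
  by (induction S rule: infinite_finite_induct) (simp_all add: lm_add)

lemma lm_lm: "lm A (lm B X) = lm (A ** B) X"
  by (simp add: left_mult_def vec_eq_iff matrix_matrix_mult_def sum_2
      scale_right_distrib scale_left_distrib ac_simps)

lemma lm_one [simp]: "lm (mat 1) X = X"
proof -
  have "(\<Sum>c\<in>UNIV. smul (mat 1 $ a $ c) (X $ c $ b)) = X $ a $ b" for a b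
  proof -
    have "(\<Sum>c\<in>UNIV. smul (mat 1 $ a $ c) (X $ c $ b)) = (\<Sum>c\<in>UNIV. if a = c then X $ c $ b else 0)"
      by (rule sum.cong) (auto simp: mat_def)
    then show ?thesis by simp
  qed
  then show ?thesis by (simp add: left_mult_def vec_eq_iff)
qed

lemma ME_basis_mult: "ME (\<I> i j ** \<I> i' j') x = (\<Sum>s\<in>UNIV. ME (\<I> (i + i') s) (smul (l i i' s j j') x))"
  by (simp add: struct_const_eq[OF basis] ME_matrix_sum)

definition crd :: "bit \<Rightarrow> 2 \<Rightarrow> 'e^2^2 \<Rightarrow> 'e" where
  "crd i j X = (\<Sum>a\<in>UNIV. \<Sum>b\<in>UNIV. smul (\<kappa> i j a b) (X $ a $ b))"

lemma crd_add: "crd i j (X + Y) = crd i j X + crd i j Y"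
  by (simp add: crd_def scale_right_distrib sum.distrib)

lemma crd_smul: "crd i j (mat_scale smul c X) = smul c (crd i j X)"
  by (simp add: crd_def mat_scale_def scale_sum_right mult.commute)

lemma crd_zero [simp]: "crd i j 0 = 0"
  by (simp add: crd_def)

lemma crd_sum: "crd i j (sum f S) = (\<Sum>s\<in>S. crd i j (f s))"
  by (induction S rule: infinite_finite_induct) (simp_all add: crd_add)

lemma crd_ME: "crd i j (ME (\<I> i' j') x) = (if i = i' \<and> j = j' then x else 0)"
proof -
  have "crd i j (ME (\<I> i' j') x) = smul (\<Sum>a\<in>UNIV. \<Sum>b\<in>UNIV. \<kappa> i j a b * \<I> i' j' $ a $ b) x"
    by (simp add: crd_def mat_elem_def scale_sum_left)
  then show ?thesis unfolding dual_orthogonal by simp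
qed

lemma ME_expand: "X = (\<Sum>i\<in>UNIV. \<Sum>j\<in>UNIV. ME (\<I> i j) (crd i j X))"
proof -
  have "(\<Sum>i\<in>UNIV. \<Sum>j\<in>UNIV. ME (\<I> i j) (crd i j X)) $ c $ d
      = (\<Sum>a\<in>UNIV. \<Sum>b\<in>UNIV. smul (\<Sum>i\<in>UNIV. \<Sum>j\<in>UNIV. \<kappa> i j a b * \<I> i j $ c $ d) (X $ a $ b))" for c d
    by (simp add: mat_elem_def crd_def sum_2 sum_bit scale_right_distrib scale_left_distrib ac_simps)
  also have "\<dots> c d = X $ c $ d" for c d
    unfolding dual_complete using exhaust_2[of c] exhaust_2[of d] by (auto simp: sum_2)
  finally show ?thesis by (simp add: vec_eq_iff)
qed

text \<open>By \<open>ME_expand\<close> the generators span additively, so an identity additive in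
  \<open>X\<close> can be checked on them.\<close>

lemma M2E_induct [case_names generator add]:
  assumes "\<And>i j x. P (ME (\<I> i j) x)" and "\<And>X Y. P X \<Longrightarrow> P Y \<Longrightarrow> P (X + Y)"
  shows "P X"
  by (subst ME_expand) (simp add: sum_bit sum_2 assms)

section \<open>Components of \<theta> and of its t-inverse\<close>

lemma theta_linear: "Vector_Spaces.linear smul (mat_scale smul) (\<theta> i)"
  using twisting by (simp add: twisting_system_def t_invertible_def)

lemma theta_add: "\<theta> i (x + y) = \<theta> i x + \<theta> i y"
  using theta_linear by (simp add: Vector_Spaces.linear_iff)

lemma theta_smul: "\<theta> i (smul c x) $ a $ b = smul c (\<theta> i x $ a $ b)"
  using theta_linear by (simp add: Vector_Spaces.linear_iff mat_scale_def)

lemma theta_zero [simp]: "\<theta> i 0 = 0"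
  using theta_add[of i 0 0] by simp

abbreviation \<phi> where "\<phi> i \<equiv> t_inverse smul (\<theta> i)"

lemma is_t_inverse_phi: "is_t_inverse smul (\<theta> i) (\<phi> i)"
  using twisting by (intro is_t_inverse_t_inverse) (simp add: twisting_system_def)

lemma theta_phi: "(\<Sum>r\<in>UNIV. \<theta> i (\<phi> i x $ a $ r) $ b $ r) = (if a = b then x else 0)"
  using is_t_inverse_phi by (simp add: is_t_inverse_def)

lemma phi_theta: "(\<Sum>r\<in>UNIV. \<phi> i (\<theta> i x $ r $ a) $ r $ b) = (if b = a then x else 0)"
  using is_t_inverse_phi by (simp add: is_t_inverse_def)

lemma phi_add: "\<phi> i (x + y) = \<phi> i x + \<phi> i y"
  using is_t_inverse_phi by (simp add: is_t_inverse_def Vector_Spaces.linear_iff)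

lemma phi_smul: "\<phi> i (smul c x) $ a $ b = smul c (\<phi> i x $ a $ b)"
  using is_t_inverse_phi[of i] by (simp add: is_t_inverse_def Vector_Spaces.linear_iff mat_scale_def)

section \<open>The operators \<open>L\<close> and the twisted product\<close>

definition L :: "'e \<Rightarrow> 'e^2^2 \<Rightarrow> 'e^2^2" where
  "L x Y = (\<Sum>i\<in>UNIV. \<Sum>j\<in>UNIV. \<Sum>s\<in>UNIV. ME (\<I> i s) (\<theta> i x $ s $ j * crd i j Y))"

text \<open>Each entry of \<open>X\<close> acts on \<open>Y\<close> through \<open>L\<close>, and
  the results combine as in a matrix product. Using entries of \<open>X\<close> rather than
  coordinates makes \<open>tm_ME\<close> valid for every scalar matrix \<open>A\<close>.\<close>

definition tm :: "'e^2^2 \<Rightarrow> 'e^2^2 \<Rightarrow> 'e^2^2" where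
  "tm X Y = (\<chi> a b. \<Sum>c\<in>UNIV. L (X $ a $ c) Y $ c $ b)"

lemma L_add_left: "L (x + y) Z = L x Z + L y Z"
  by (simp add: L_def theta_add distrib_right ME_add sum.distrib)

lemma L_smul_left: "L (smul c x) Z = mat_scale smul c (L x Z)"
proof -
  interpret M: vector_space "mat_scale smul" by (rule vs_mat)
  show ?thesis by (simp add: L_def theta_smul smul_mult_left ME_smul M.scale_sum_right)
qed

lemma L_add_right: "L x (Y + Z) = L x Y + L x Z"
  by (simp add: L_def crd_add distrib_left ME_add sum.distrib)

lemma L_smul_right: "L x (mat_scale smul c Z) = mat_scale smul c (L x Z)"
proof -
  interpret M: vector_space "mat_scale smul" by (rule vs_mat)
  show ?thesis by (simp add: L_def crd_smul smul_mult_right ME_smul M.scale_sum_right)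
qed

lemma L_zero_right [simp]: "L x 0 = 0"
  by (simp add: L_def)

lemma L_sum_right: "L x (sum f S) = (\<Sum>s\<in>S. L x (f s))"
  by (induction S rule: infinite_finite_induct) (simp_all add: L_add_right)

lemma L_generator: "L x (ME (\<I> i j) y) = (\<Sum>s\<in>UNIV. ME (\<I> i s) (\<theta> i x $ s $ j * y))"
proof -
  \<comment> \<open>The conditionals are nested so that the sum over \<open>j'\<close> collapses
    first, then the one over \<open>i'\<close>.\<close>
  have k: "(\<Sum>s\<in>UNIV. ME (\<I> i' s) (\<theta> i' x $ s $ j' * crd i' j' (ME (\<I> i j) y))) =
      (if j' = j then if i' = i then \<Sum>s\<in>UNIV. ME (\<I> i s) (\<theta> i x $ s $ j * y) else 0 else 0)" for i' j'
    by (auto simp: crd_ME)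
  show ?thesis by (simp add: L_def k)
qed

lemma tm_add_left: "tm (X + Y) Z = tm X Z + tm Y Z"
  by (simp add: tm_def L_add_left vec_eq_iff sum.distrib)

lemma tm_add_right: "tm X (Y + Z) = tm X Y + tm X Z"
  by (simp add: tm_def L_add_right vec_eq_iff sum.distrib)

lemma tm_smul_left: "tm (mat_scale smul c X) Y = mat_scale smul c (tm X Y)"
  by (simp add: tm_def mat_scale_def L_smul_left vec_eq_iff scale_sum_right)

lemma tm_smul_right: "tm X (mat_scale smul c Y) = mat_scale smul c (tm X Y)"
  unfolding tm_def L_smul_right by (simp add: mat_scale_def vec_eq_iff scale_sum_right)

lemma L_zero_left [simp]: "L 0 Y = 0"
  by (simp add: L_def)

lemma tm_zero_left [simp]: "tm 0 Y = 0"
  by (simp add: tm_def vec_eq_iff)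

lemma tm_sum_left: "tm (sum f S) Y = (\<Sum>s\<in>S. tm (f s) Y)"
  by (induction S rule: infinite_finite_induct) (simp_all add: tm_add_left)

lemma tm_ME: "tm (ME A x) Y = lm A (L x Y)"
  by (simp add: tm_def left_mult_def mat_elem_def L_smul_left vec_eq_iff) (simp add: mat_scale_def)

lemma tm_lm: "tm (lm A X) Y = lm A (tm X Y)"
proof (induction X rule: M2E_induct)
  case (generator i j x)
  show ?case by (simp add: lm_ME tm_ME lm_lm)
qed (simp add: lm_add tm_add_left)

lemma tm_generators:
  "tm (ME (\<I> i j) x) (ME (\<I> i' j') x') = (\<Sum>s\<in>UNIV. ME (\<I> i j ** \<I> i' s) (\<theta> i' x $ s $ j' * x'))"
  by (simp add: tm_ME L_generator lm_sum lm_ME)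

lemma is_twisted_mult_tm: "is_twisted_mult smul \<theta> \<I> tm"
  unfolding is_twisted_mult_def tm_generators
  by (auto intro!: linearI' vs_mat simp: tm_add_left tm_add_right tm_smul_left tm_smul_right
      ME_basis_mult)

lemma is_twisted_mult_unique:
  assumes "is_twisted_mult smul \<theta> \<I> m"
  shows "m = tm"
proof -
  have add: "m (X + Y) Z = m X Z + m Y Z" "m X (Y + Z) = m X Y + m X Z" for X Y Z
    using assms by (simp_all add: is_twisted_mult_def Vector_Spaces.linear_iff)
  have gen: "m (ME (\<I> i j) x) (ME (\<I> i' j') x') = tm (ME (\<I> i j) x) (ME (\<I> i' j') x')"
    for i j x i' j' x'
    using assms unfolding tm_generators is_twisted_mult_def by blast
  have "m X (ME (\<I> i' j') x') = tm X (ME (\<I> i' j') x')" for X i' j' x'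
    by (induction X rule: M2E_induct) (simp_all add: add gen tm_add_left)
  then have "m X Y = tm X Y" for X Y
    by (induction Y rule: M2E_induct) (simp_all add: add tm_add_right)
  then show ?thesis by blast
qed

section \<open>Associativity\<close>

lemma twisting_eq:
  "(\<Sum>s\<in>UNIV. \<Sum>u\<in>UNIV. smul (l i' i'' p s u) (\<theta> i'' (\<theta> i' x $ s $ j' * x') $ u $ j'')) =
   (\<Sum>t\<in>UNIV. \<Sum>u\<in>UNIV. smul (l i' i'' t j' u) (\<theta> (i' + i'') x $ p $ t * \<theta> i'' x' $ u $ j''))"
  using twisting by (simp add: twisting_system_def)

text \<open>On generators, comparing coefficients of \<open>\<I> (i' + i'') p\<close> and splitting
  off the common right factor \<open>x''\<close> leaves condition (1).\<close>

lemma tm_L: "tm (L x Y) Z = L x (tm Y Z)"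
proof -
  have gen: "tm (L x (ME (\<I> i' j') x')) (ME (\<I> i'' j'') x'') =
      L x (tm (ME (\<I> i' j') x') (ME (\<I> i'' j'') x''))" for i' j' x' i'' j'' x''
  proof -
    have "tm (L x (ME (\<I> i' j') x')) (ME (\<I> i'' j'') x'') =
        (\<Sum>s\<in>UNIV. \<Sum>u\<in>UNIV. \<Sum>p\<in>UNIV. ME (\<I> (i' + i'') p)
          (smul (l i' i'' p s u) (\<theta> i'' (\<theta> i' x $ s $ j' * x') $ u $ j'') * x''))"
      by (simp add: L_generator tm_sum_left tm_generators ME_basis_mult smul_mult_left)
    also have "\<dots> = (\<Sum>p\<in>UNIV. ME (\<I> (i' + i'') p)
        ((\<Sum>s\<in>UNIV. \<Sum>u\<in>UNIV. smul (l i' i'' p s u) (\<theta> i'' (\<theta> i' x $ s $ j' * x') $ u $ j'')) * x''))"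
      by (simp add: sum_2 distrib_right ME_add ac_simps)
    also have "\<dots> = (\<Sum>p\<in>UNIV. ME (\<I> (i' + i'') p)
        ((\<Sum>t\<in>UNIV. \<Sum>u\<in>UNIV. smul (l i' i'' t j' u)
          (\<theta> (i' + i'') x $ p $ t * \<theta> i'' x' $ u $ j'')) * x''))"
      unfolding twisting_eq ..
    also have "\<dots> = (\<Sum>u\<in>UNIV. \<Sum>t\<in>UNIV. \<Sum>p\<in>UNIV. ME (\<I> (i' + i'') p)
          (smul (l i' i'' t j' u) (\<theta> (i' + i'') x $ p $ t * \<theta> i'' x' $ u $ j'') * x''))"
      by (simp add: sum_2 distrib_right ME_add ac_simps)
    also have "\<dots> = L x (tm (ME (\<I> i' j') x') (ME (\<I> i'' j'') x''))"
      by (simp add: tm_generators ME_basis_mult L_sum_right L_generator smul_mult_left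
          smul_mult_right mult.assoc)
    finally show ?thesis .
  qed
  have "tm (L x Y) (ME (\<I> i'' j'') x'') = L x (tm Y (ME (\<I> i'' j'') x''))" for i'' j'' x''
    by (induction Y rule: M2E_induct) (simp_all add: gen tm_add_left L_add_right)
  then show ?thesis
    by (induction Z rule: M2E_induct) (simp_all add: tm_add_right L_add_right)
qed

text \<open>For a generator \<open>X = ME A x\<close> both sides equal
  \<open>lm A (L x (tm Y Z))\<close>: the factor \<open>A\<close> passes through by
  \<open>tm_lm\<close>, and \<open>L x\<close> by \<open>tm_L\<close>.\<close>

lemma tm_assoc: "tm (tm X Y) Z = tm X (tm Y Z)"
  by (induction X rule: M2E_induct) (simp_all add: tm_ME tm_lm tm_L tm_add_left)

section \<open>The grading\<close>

lemma M2E_comp_eq: "M2E_comp smul \<I> i = {X. \<forall>j. crd (i + 1) j X = 0}"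
proof (intro set_eqI iffI)
  fix X assume "X \<in> M2E_comp smul \<I> i"
  then show "X \<in> {X. \<forall>j. crd (i + 1) j X = 0}"
    by (auto simp: M2E_comp_def crd_add crd_ME)
next
  fix X assume "X \<in> {X. \<forall>j. crd (i + 1) j X = 0}"
  \<comment> \<open>In the integers mod 2 the only other degree is \<open>i + 1\<close>, so the
    expansion of \<open>X\<close> reduces to degree \<open>i\<close>.\<close>
  then have "X = (\<Sum>j\<in>UNIV. ME (\<I> i j) (crd i j X))"
    by (subst ME_expand) (cases i; simp add: sum_bit)
  then show "X \<in> M2E_comp smul \<I> i"
    by (auto simp: M2E_comp_def sum_2)
qed

lemma ME_in_comp: "ME (\<I> i j) x \<in> M2E_comp smul \<I> i"
  by (simp add: M2E_comp_eq crd_ME)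

lemma M2E_comp_direct: "\<exists>!f. (\<forall>i. f i \<in> M2E_comp smul \<I> i) \<and> X = f 0 + f 1"
proof (rule ex1I)
  show "(\<forall>i. (\<Sum>j\<in>UNIV. ME (\<I> i j) (crd i j X)) \<in> M2E_comp smul \<I> i) \<and>
      X = (\<Sum>j\<in>UNIV. ME (\<I> 0 j) (crd 0 j X)) + (\<Sum>j\<in>UNIV. ME (\<I> 1 j) (crd 1 j X))"
    using ME_expand[of X] by (auto simp: M2E_comp_eq crd_sum crd_ME sum_bit)
next
  fix f assume f: "(\<forall>i. f i \<in> M2E_comp smul \<I> i) \<and> X = f 0 + f 1"
  have "f i = (\<Sum>j\<in>UNIV. ME (\<I> i j) (crd i j X))" for i
  proof -
    have z: "crd (i + 1) j (f i) = 0" for i j using f by (auto simp: M2E_comp_eq)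
    \<comment> \<open>The other summand of \<open>X\<close> has no coordinates in degree
      \<open>i\<close>.\<close>
    have "crd i j X = crd i j (f i)" for j
      using f z[of 0 j] z[of 1 j] by (cases i) (auto simp: crd_add)
    then show ?thesis
      using z[of i] by (subst ME_expand) (cases i; simp add: sum_bit)
  qed
  then show "f = (\<lambda>i. \<Sum>j\<in>UNIV. ME (\<I> i j) (crd i j X))" by blast
qed

lemma M2E_comp_add: "X \<in> M2E_comp smul \<I> i \<Longrightarrow> Y \<in> M2E_comp smul \<I> i \<Longrightarrow> X + Y \<in> M2E_comp smul \<I> i"
  by (simp add: M2E_comp_eq crd_add)

lemma M2E_comp_sum: "(\<And>s. s \<in> S \<Longrightarrow> f s \<in> M2E_comp smul \<I> i) \<Longrightarrow> sum f S \<in> M2E_comp smul \<I> i"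
  by (simp add: M2E_comp_eq crd_sum)

lemma tm_comp:
  assumes "X \<in> M2E_comp smul \<I> i" "Y \<in> M2E_comp smul \<I> i'"
  shows "tm X Y \<in> M2E_comp smul \<I> (i + i')"
proof -
  have "tm (ME (\<I> i j) x) (ME (\<I> i' j') x') \<in> M2E_comp smul \<I> (i + i')" for j x j' x'
    unfolding tm_generators ME_basis_mult by (intro M2E_comp_sum ME_in_comp)
  with assms show ?thesis
    by (auto simp: M2E_comp_def[of _ _ i] M2E_comp_def[of _ _ i'] tm_add_left tm_add_right
        intro!: M2E_comp_add)
qed

section \<open>The identity element\<close>

lemma L_phi: "(\<Sum>r\<in>UNIV. L (\<phi> i x $ u $ r) (ME (\<I> i r) 1)) = ME (\<I> i u) x"
proof -
  \<comment> \<open>The coefficient of \<open>\<I> i s\<close> is the left side of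
    \<open>theta_phi\<close>. Hence the elements \<open>L y (ME (\<I> i r) 1)\<close> span
    additively, which is how t-invertibility enters both the study of \<open>L 1\<close> and the
    right unit law.\<close>
  have "(\<Sum>r\<in>UNIV. L (\<phi> i x $ u $ r) (ME (\<I> i r) 1))
      = (\<Sum>s\<in>UNIV. ME (\<I> i s) (\<Sum>r\<in>UNIV. \<theta> i (\<phi> i x $ u $ r) $ s $ r))"
    by (simp add: L_generator ME_sum) (rule sum.swap)
  also have "\<dots> = (\<Sum>s\<in>UNIV. if u = s then ME (\<I> i s) x else 0)"
    unfolding theta_phi by (rule sum.cong) auto
  finally show ?thesis by simp
qed

text \<open>Condition (2) makes \<open>L 1\<close> act on the odd part by scalar matrices \<open>C j\<close>. Since \<open>L 1\<close>
  commutes with twisted right multiplications, and the products of \<open>\<I> 1 1\<close> with \<open>M\<^sub>2(E)\<close> fill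
  \<open>M\<^sub>2(E)\<close> by \<open>t\<close>-invertibility, \<open>L 1\<close> is left multiplication by a single matrix \<open>D\<close>.\<close>

lemma L_one_eq_left_mult:
  "\<exists>D H. H \<in> mat_comp 0 \<and> (\<forall>X. L 1 X = lm D X) \<and>
    (\<forall>X. lm H (lm D X) = X) \<and> (\<forall>X. lm D (lm H X) = X)"
proof -
  obtain A where A: "invertible A" "\<theta> 1 1 = ME A 1"
    using twisting by (auto simp: twisting_system_def)
  then obtain A' where A': "A ** A' = mat 1"
    by (auto simp: invertible_def)
  have "invertible (\<I> 1 1)" using basis by (simp add: invertible_graded_basis_def)
  then obtain B where B: "\<I> 1 1 ** B = mat 1" "B ** \<I> 1 1 = mat 1"
    by (auto simp: invertible_def)
  \<comment> \<open>By condition (2), \<open>L 1\<close> replaces \<open>\<I> 1 j\<close> by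
    \<open>C j\<close>. As \<open>B\<close> inverts \<open>\<I> 1 1\<close>, the matrix
    \<open>D\<close> is the one with \<open>D ** \<I> 1 1 = C 1\<close>.\<close>
  define C where "C j = (\<Sum>s\<in>UNIV. mat_scale (*) (A $ s $ j) (\<I> 1 s))" for j
  define D where "D = C 1 ** B"
  have LC: "L 1 (ME (\<I> 1 j) x) = ME (C j) x" for j x
    by (simp add: L_generator A(2) C_def ME_matrix_sum mat_elem_def[of _ A] smul_mult_left)
  have D_B: "L 1 (lm (\<I> 1 1) W) = lm (C 1) W" for W
  proof (induction W rule: M2E_induct)
    case (generator i u x)
    \<comment> \<open>Written as a sum of twisted products with left factors in
      \<open>\<I> 1 1\<close> E, the element lets \<open>L 1\<close> move onto those factors by
      \<open>tm_L\<close>, where \<open>LC\<close> evaluates it.\<close>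
    have "lm (\<I> 1 1) (ME (\<I> i u) x) = (\<Sum>r\<in>UNIV. tm (ME (\<I> 1 1) (\<phi> i x $ u $ r)) (ME (\<I> i r) 1))"
      by (subst L_phi[symmetric]) (simp add: lm_sum tm_ME)
    then have "L 1 (lm (\<I> 1 1) (ME (\<I> i u) x))
        = (\<Sum>r\<in>UNIV. tm (L 1 (ME (\<I> 1 1) (\<phi> i x $ u $ r))) (ME (\<I> i r) 1))"
      by (simp add: L_sum_right tm_L)
    also have "\<dots> = lm (C 1) (\<Sum>r\<in>UNIV. L (\<phi> i x $ u $ r) (ME (\<I> i r) 1))"
      by (simp add: LC tm_ME lm_sum)
    finally show ?case unfolding L_phi .
  qed (simp add: lm_add L_add_right)
  have LD: "L 1 X = lm D X" for X
    using D_B[of "lm B X"] by (simp add: lm_lm B D_def)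
  \<comment> \<open>The coordinates of \<open>G\<close> are the first column of the inverse of
    \<open>A\<close>, so \<open>L 1\<close> sends \<open>G\<close> to \<open>\<I> 1 1\<close>; thus
    \<open>G ** B\<close> is the candidate for the inverse of \<open>D\<close>.\<close>
  define G where "G = (\<Sum>j\<in>UNIV. mat_scale (*) (A' $ j $ 1) (\<I> 1 j))"
  have "(\<Sum>j\<in>UNIV. A $ s $ j * A' $ j $ 1) = of_bool (s = 1)" for s
    using A' by (auto simp: vec_eq_iff matrix_matrix_mult_def mat_def)
  then have AA: "(\<Sum>j\<in>UNIV. smul (A $ s $ j * A' $ j $ 1) x) = (if s = 1 then x else 0)" for s x
    by (simp flip: scale_sum_left)
  have DG: "ME (D ** G) x = ME (\<I> 1 1) x" for x
  proof -
    have "ME (D ** G) x = L 1 (ME G x)" by (simp add: LD lm_ME)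
    also have "\<dots> = (\<Sum>s\<in>UNIV. ME (\<I> 1 s) (\<Sum>j\<in>UNIV. smul (A $ s $ j * A' $ j $ 1) x))"
      by (simp add: G_def ME_matrix_sum L_sum_right LC C_def ME_sum) (rule sum.swap)
    also have "\<dots> = ME (\<I> 1 1) x"
      unfolding AA by (simp add: sum_2)
    finally show ?thesis .
  qed
  have inverses: "lm (G ** B) (lm D X) = X \<and> lm D (lm (G ** B) X) = X" for X
  proof (cases "(1::'e) = 0")
    \<comment> \<open>Over the zero algebra \<open>DG\<close> says nothing about the entries of
      \<open>D ** G\<close>, but there all matrices over E coincide.\<close>
    case True
    then have "x = 0" for x :: 'e by (metis mult_1_left mult_zero_left)
    then have "Y = Z" for Y Z :: "'e^2^2" by (metis vec_eq_iff)
    then show ?thesis by blast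
  next
    case False
    have "D ** G = \<I> 1 1"
      using DG[of 1] False by (simp add: mat_elem_def vec_eq_iff)
    then have "D ** (G ** B) = mat 1" by (simp add: matrix_mul_assoc B)
    moreover from this have "(G ** B) ** D = mat 1" using matrix_left_right_inverse by blast
    ultimately show ?thesis by (simp add: lm_lm)
  qed
  \<comment> \<open>Both \<open>G\<close> and \<open>B\<close> are odd, the latter as the inverse of
    an odd matrix, so the product is even and has coordinates in \<open>\<I> 0\<close>.\<close>
  have "G \<in> mat_comp 1"
    using graded_basis_in_comp[OF basis, of 1] by (auto simp: G_def mat_comp_def mat_scale_def)
  moreover have "B \<in> mat_comp 1"
    using B(1) graded_basis_in_comp[OF basis, of 1 1]
    by (auto simp: mat_comp_def matrix_matrix_mult_def vec_eq_iff sum_2 forall_2 mat_def)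
  ultimately have "G ** B \<in> mat_comp 0" using mat_comp_mult[of G 1 B 1] by simp
  then show ?thesis using LD inverses by blast
qed

text \<open>The identity is the scalar matrix \<open>H\<close> inverse to the action of
  \<open>L 1\<close>; the formula with the t-inverse arises by solving
  \<open>L 1 (ME H 1) = ME (mat 1) 1\<close> for the coordinates of \<open>H\<close>.\<close>

lemma twisted_unit_neutral:
  "tm (twisted_unit smul \<theta> \<I>) X = X" "tm X (twisted_unit smul \<theta> \<I>) = X"
proof -
  obtain D H where H: "H \<in> mat_comp 0" and act: "\<forall>X. L 1 X = lm D X"
      "\<forall>X. lm H (lm D X) = X" "\<forall>X. lm D (lm H X) = X"
    using L_one_eq_left_mult by (elim exE conjE)
  note LD = act(1)[rule_format] and HD = act(2)[rule_format] and DH = act(3)[rule_format]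
  obtain h where h: "H = (\<Sum>s\<in>UNIV. mat_scale (*) (h s) (\<I> 0 s))"
    using graded_basis_coords[OF basis H] by blast
  have LH: "L 1 (ME H 1) = ME (mat 1) 1"
    using DH[of "ME (mat 1) 1"] by (simp add: LD lm_ME)
  \<comment> \<open>Degree 0 coordinates of \<open>LH\<close>: the components of
    \<open>\<theta> 0\<close> take the coordinates \<open>h\<close> to those of the identity
    matrix.\<close>
  have "(\<Sum>j\<in>UNIV. \<theta> 0 (smul (h j) 1) $ s $ j) = smul (unit_coord \<I> s) 1" for s
  proof -
    have "(\<Sum>j\<in>UNIV. \<theta> 0 (smul (h j) 1) $ s $ j) = crd 0 s (L 1 (ME H 1))"
      by (simp add: h ME_matrix_sum L_sum_right L_generator crd_sum crd_ME theta_smul smul_mult_right)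
    also have "\<dots> = smul (unit_coord \<I> s) 1"
      unfolding LH by (subst unit_coord_eq[OF basis, symmetric])
        (simp add: ME_matrix_sum crd_sum crd_ME)
    finally show ?thesis .
  qed
  note coord = this
  have "smul (h i) 1 = (\<Sum>r\<in>UNIV. smul (unit_coord \<I> r) (\<phi> 0 1 $ r $ i))" for i
  proof -
    \<comment> \<open>The t-inverse identity \<open>phi_theta\<close> inverts this system and
      isolates \<open>h i\<close>.\<close>
    have "smul (h i) 1 = (\<Sum>j\<in>UNIV. \<Sum>r\<in>UNIV. \<phi> 0 (\<theta> 0 (smul (h j) 1) $ r $ j) $ r $ i)"
      unfolding phi_theta by simp
    also have "\<dots> = (\<Sum>r\<in>UNIV. \<phi> 0 (\<Sum>j\<in>UNIV. \<theta> 0 (smul (h j) 1) $ r $ j) $ r $ i)"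
      by (simp add: sum_2 phi_add ac_simps)
    finally show ?thesis unfolding coord by (simp add: phi_smul)
  qed
  then have unit: "twisted_unit smul \<theta> \<I> = ME H 1"
    by (simp add: twisted_unit_def h ME_matrix_sum ME_sum)
  show "tm (twisted_unit smul \<theta> \<I>) X = X"
    by (simp add: unit tm_ME LD HD)
  have gen: "tm (ME (\<I> i r) 1) (ME H 1) = ME (\<I> i r) 1" for i r
    by (simp add: tm_ME LH lm_ME)
  show "tm X (twisted_unit smul \<theta> \<I>) = X"
    unfolding unit
  proof (induction X rule: M2E_induct)
    case (generator i u x)
    \<comment> \<open>Both occurrences of the generator are expanded by \<open>L_phi\<close>;
      \<open>tm_L\<close> then moves right multiplication by the unit inside \<open>L\<close>, where
      \<open>gen\<close> applies.\<close>
    show ?case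
      by (subst (1 2) L_phi[symmetric]) (simp add: tm_sum_left tm_L gen)
  qed (simp add: tm_add_left)
qed

lemma Z2_graded_algebra_tm:
  "Z2_graded_algebra (mat_scale smul) tm (twisted_unit smul \<theta> \<I>) (M2E_comp smul \<I>)"
proof -
  interpret M: vector_space "mat_scale smul" by (rule vs_mat)
  show ?thesis
  proof unfold_locales
    show "M.subspace (M2E_comp smul \<I> i)" for i
      by (simp add: M.subspace_def M2E_comp_eq crd_add crd_smul)
    show "twisted_unit smul \<theta> \<I> \<in> M2E_comp smul \<I> 0"
      unfolding twisted_unit_def by (intro M2E_comp_sum ME_in_comp)
    show "tm X Y \<in> M2E_comp smul \<I> (i + i')"
      if "X \<in> M2E_comp smul \<I> i" "Y \<in> M2E_comp smul \<I> i'" for X Y i i'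
      using that by (rule tm_comp)
  qed (auto intro!: linearI' vs_mat M2E_comp_direct
      simp: tm_add_left tm_add_right tm_smul_left tm_smul_right tm_assoc twisted_unit_neutral)
qed

end

theorem theorem2p7:
  fixes smul :: "'k::{alg_closed_field,field_char_0} \<Rightarrow> 'e::{ring,monoid_mult} \<Rightarrow> 'e"
    and \<theta> :: "bit \<Rightarrow> 'e \<Rightarrow> 'e^2^2"
    and \<I> :: "bit \<Rightarrow> 2 \<Rightarrow> 'k^2^2"
  assumes "unital_algebra smul (*) 1"
    and "twisting_system smul \<theta> \<I>"
  shows "(\<exists>!m. is_twisted_mult smul \<theta> \<I> m) \<and>
    (\<forall>m. is_twisted_mult smul \<theta> \<I> m \<longrightarrow>
      Z2_graded_algebra (mat_scale smul) m (twisted_unit smul \<theta> \<I>) (M2E_comp smul \<I>))"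
proof -
  have "invertible_graded_basis \<I>"
    using assms(2) by (simp add: twisting_system_def)
  then obtain \<kappa> where \<kappa>:
    "\<forall>a b c d. (\<Sum>i\<in>UNIV. \<Sum>j\<in>UNIV. \<kappa> i j a b * \<I> i j $ c $ d) = of_bool (a = c \<and> b = d)"
    "\<forall>i j i' j'. (\<Sum>a\<in>UNIV. \<Sum>b\<in>UNIV. \<kappa> i j a b * \<I> i' j' $ a $ b) = of_bool (i = i' \<and> j = j')"
    using invertible_graded_basis_dual by blast
  interpret twisted_matrix_algebra smul \<theta> \<I> \<kappa>
    using assms \<kappa>
    by (intro twisted_matrix_algebra.intro twisted_matrix_algebra_axioms.intro; blast)
  show ?thesis
    using is_twisted_mult_tm is_twisted_mult_unique Z2_graded_algebra_tm by metis
qed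

end
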